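(* Let $\mathbb{F}$ be a field, let $B=\{\vec b_1,\dots,\vec b_n\}$ and $B'=\{\vec b'_1,\dots,\vec b'_n\}$ be ordered bases of $\mathbb{F}^n$ (possibly equal), and let $\bar\mu$ be the function associated with $B,B'$ (defined in the context). Let $1\le k_2<k_1\le n$ and consider $$C_2=\mathrm{Span}_{\mathbb{F}}\{\vec b_1,\dots,\vec b_{k_2}\}\subseteq C_1=\mathrm{Span}_{\mathbb{F}}\{\vec b_1,\dots,\vec b_{k_1}\}.$$ Write $t=k_1-k_2$, consider $1\le k\le t$, and put $$a:=\min\{\bar\mu(i_1,\dots,i_{t-k+1})\mid k_2<i_1<\cdots<i_{t-k+1}\le k_1\}.$$ 1. For all $A\subseteq\{1,\dots,n\}$ with $\#A<a$ there exist $k$ linearly independent vectors in $C_1\backslash C_2$ that are identically equal to $0$ on $A$ (i.e. their $i$-th coordinate is $0$ for every $i\in A$). 2. When $M_{t-k+1}(C_2^\perp,C_1^\perp)=a$, for some $A\subseteq\{1,\dots,n\}$ of size equal to $a$ there do not exist $k$ such linearly independent vectors.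
   Context: Let $\ast$ denote the component-wise product on $\mathbb{F}^n$, and let $\perp$ denote the orthogonal space with respect to the usual inner product $\vec c\cdot\vec d=\sum_i c_id_i$ on $\mathbb{F}^n$. Put $\mathcal I=\{1,\dots,n\}$. Set $L_0=\{\vec 0\}$ and $L_i=\mathrm{Span}_{\mathbb{F}}\{\vec b_1,\dots,\vec b_i\}$ for $i=1,\dots,n$. Define $\bar\rho:\mathbb{F}^n\to\{0,1,\dots,n\}$ by $\bar\rho(\vec 0)=0$ and, for $\vec c\neq\vec 0$, $\bar\rho(\vec c)=i$ if $\vec c\in L_i\setminus L_{i-1}$. An ordered pair $(i,j)\in\mathcal I^2$ is one-way well-behaving (OWB) if $\bar\rho(\vec b_u\ast\vec b'_j)<\bar\rho(\vec b_i\ast\vec b'_j)$ for all $u<i$. For $l\in\mathcal I$ define $$V_l:=\{i\in\mathcal I\mid \bar\rho(\vec b_i\ast\vec b'_j)=l\text{ for some }\vec b'_j\in B'\text{ with }(i,j)\text{ OWB}\},$$ and for $\{l_1,\dots,l_s\}\subseteq\mathcal I$ define $$\bar\mu(l_1,\dots,l_s):=\#\Big(\big(V_{l_1}\cup\cdots\cup V_{l_s}\big)\cup\{l_1,\dots,l_s\}\Big).$$ For a subspace $D\subseteq\mathbb{F}^n$, $\mathrm{Supp}(D):=\{i\in\mathcal I\mid c_i\ne0\text{ for some }(c_1,\dots,c_n)\in D\}$. For subspaces $E_2\subsetneq E_1\subseteq\mathbb{F}^n$ and $1\le r\le\dim E_1-\dim E_2$, the $r$-th relative generalized Hamming weight is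 $$M_r(E_1,E_2):=\min\{\#\mathrm{Supp}(D)\mid D\subseteq E_1\text{ a subspace},\ D\cap E_2=\{\vec 0\},\ \dim D=r\}.$$
   Formalization: "Linearly independent vectors in C_1\C_2" means independent modulo C_2 (their span meets C_2 only in 0); with independence in F^n alone, item 2 fails, e.g. for standard bases with n=4, k_2=2, k_1=4, k=2. *)

theory Defs
  imports "HOL-Analysis.Analysis"
begin

text \<open>
  The space \<open>F\<^sup>n\<close> is \<^typ>\<open>'a::field ^ 'n\<close> with \<open>n = CARD('n)\<close>; coordinates are indexed by \<^typ>\<open>'n\<close>.
  An ordered basis is a function \<open>b\<close> on the naturals of which only \<open>b 1, \<dots>, b n\<close> are used.
  The product \<open>*\<close> on \<^typ>\<open>'a::field ^ 'n\<close> is the component-wise one of the library.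
\<close>

definition ordered_basis :: "(nat \<Rightarrow> 'a::field ^ 'n) \<Rightarrow> bool" where
  "ordered_basis b \<longleftrightarrow>
     inj_on b {1..CARD('n)} \<and> vec.independent (b ` {1..CARD('n)}) \<and> vec.span (b ` {1..CARD('n)}) = UNIV"

definition flag :: "(nat \<Rightarrow> 'a::field ^ 'n) \<Rightarrow> nat \<Rightarrow> ('a ^ 'n) set" where
  "flag b i = vec.span (b ` {1..i})"

definition rho_bar :: "(nat \<Rightarrow> 'a::field ^ 'n) \<Rightarrow> 'a ^ 'n \<Rightarrow> nat" where
  "rho_bar b c =
     (if c = 0 then 0 else (THE i. i \<in> {1..CARD('n)} \<and> c \<in> flag b i - flag b (i - 1)))"

definition OWB :: "(nat \<Rightarrow> 'a::field ^ 'n) \<Rightarrow> (nat \<Rightarrow> 'a ^ 'n) \<Rightarrow> nat \<Rightarrow> nat \<Rightarrow> bool" where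
  "OWB b b' i j \<longleftrightarrow>
     i \<in> {1..CARD('n)} \<and> j \<in> {1..CARD('n)} \<and>
     (\<forall>u \<in> {1..CARD('n)}. u < i \<longrightarrow> rho_bar b (b u * b' j) < rho_bar b (b i * b' j))"

definition V_set :: "(nat \<Rightarrow> 'a::field ^ 'n) \<Rightarrow> (nat \<Rightarrow> 'a ^ 'n) \<Rightarrow> nat \<Rightarrow> nat set" where
  "V_set b b' l =
     {i \<in> {1..CARD('n)}. \<exists>j \<in> {1..CARD('n)}. OWB b b' i j \<and> rho_bar b (b i * b' j) = l}"

definition mu_bar :: "(nat \<Rightarrow> 'a::field ^ 'n) \<Rightarrow> (nat \<Rightarrow> 'a ^ 'n) \<Rightarrow> nat set \<Rightarrow> nat" where
  "mu_bar b b' ls = card ((\<Union>l\<in>ls. V_set b b' l) \<union> ls)"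

definition dot :: "'a::field ^ 'n \<Rightarrow> 'a ^ 'n \<Rightarrow> 'a" where
  "dot c d = (\<Sum>i\<in>UNIV. c $ i * d $ i)"

definition dual :: "('a::field ^ 'n) set \<Rightarrow> ('a ^ 'n) set" where
  "dual C = {d. \<forall>c\<in>C. dot c d = 0}"

definition Supp :: "('a::field ^ 'n) set \<Rightarrow> 'n set" where
  "Supp D = {i. \<exists>c\<in>D. c $ i \<noteq> 0}"

definition rghw :: "nat \<Rightarrow> ('a::field ^ 'n) set \<Rightarrow> ('a ^ 'n) set \<Rightarrow> nat" where
  "rghw r E1 E2 =
     Min {card (Supp D) | D. vec.subspace D \<and> D \<subseteq> E1 \<and> D \<inter> E2 = {0} \<and> vec.dim D = r}"

text \<open>
  Linear independence of vectors of \<open>C\<^sub>1 - C\<^sub>2\<close> is understood modulo \<open>C\<^sub>2\<close>, that is, for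
  their classes in \<open>C\<^sub>1 / C\<^sub>2\<close>: the vectors are independent and no nontrivial linear
  combination of them lies in \<open>C\<^sub>2\<close>.  Mere independence in the ambient space would not do:
  if \<open>v \<in> C\<^sub>1 - C\<^sub>2\<close> and \<open>0 \<noteq> w \<in> C\<^sub>2\<close> both vanish on \<open>A\<close>, then \<open>v\<close> and \<open>v + w\<close> are independent
  elements of \<open>C\<^sub>1 - C\<^sub>2\<close> vanishing on \<open>A\<close>.
\<close>

definition independent_mod :: "('a::field ^ 'n) set \<Rightarrow> ('a ^ 'n) set \<Rightarrow> bool" where
  "independent_mod E S \<longleftrightarrow> vec.independent S \<and> vec.span S \<inter> E = {0}"

definition has_independent_vanishing ::
  "nat \<Rightarrow> ('a::field ^ 'n) set \<Rightarrow> ('a ^ 'n) set \<Rightarrow> 'n set \<Rightarrow> bool" where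
  "has_independent_vanishing k C1 C2 A \<longleftrightarrow>
     (\<exists>S. S \<subseteq> C1 - C2 \<and> finite S \<and> card S = k \<and> independent_mod C2 S \<and> (\<forall>c\<in>S. \<forall>i\<in>A. c $ i = 0))"

end

theory Submission
  imports Defs
begin

text \<open>
  Let \<open>Z\<close> be the space of all vectors that vanish on \<open>A\<close>, and call the numbers \<open>rho_bar b x\<close> with
  \<open>0 \<noteq> x \<in> Z\<close> the leading indices of \<open>Z\<close>.  Everything rests on \<open>Z\<close> being an ideal for the
  component-wise product.

  For the first part, suppose that \<open>l\<close> is not a leading index of \<open>Z\<close>.  Then no \<open>i\<close> in \<open>V_l\<close> is one
  either: if \<open>x \<in> Z\<close> has leading index \<open>i\<close> and \<open>(i, j)\<close> is the one-way well-behaving pair that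
  puts \<open>i\<close> into \<open>V_l\<close>, the lower terms of \<open>x\<close> cannot disturb the leading term of \<open>b i * b' j\<close>, so
  that \<open>x * b' j\<close>, which is in \<open>Z\<close>, has leading index \<open>l\<close>
  (\<open>V_set_disjoint_leading_indices\<close>).  Since \<open>Z\<close> has at least \<open>dim Z = n - #A\<close> leading indices,
  \<open>mu_bar\<close> of any set of non-leading indices is at most \<open>#A\<close> (\<open>mu_bar_le_card_zeros\<close>).  Hence, if
  \<open>#A < a\<close>, fewer than \<open>t - k + 1\<close> of the \<open>t\<close> numbers in \<open>{k2<..k1}\<close> are non-leading, and at least
  \<open>k\<close> of them are leading indices.  Vectors of \<open>Z\<close> with these leading indices lie in \<open>C1 - C2\<close> and
  are independent modulo \<open>C2\<close>, because they have distinct leading indices above \<open>k2\<close>.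

  For the second part, let \<open>D\<close> attain the relative weight and let \<open>A\<close> be its support.  A space
  \<open>U \<subseteq> C1\<close> of dimension \<open>k\<close> that meets \<open>C2\<close> trivially and vanishes on \<open>A\<close> would be orthogonal to \<open>D\<close>.
  Then \<open>D + dual C1 \<subseteq> dual (U + C2)\<close>, where the sum on the left is direct, and comparing
  dimensions gives \<open>dim D \<le> t - k\<close> (\<open>no_independent_vanishing_on_Supp\<close>), one less than \<open>dim D\<close> is.
\<close>

section \<open>Orthogonal spaces and relative weights\<close>

lemma dot_add_left: "dot (x + y) d = dot x d + dot y d"
  by (simp add: dot_def sum.distrib distrib_right)

lemma dot_add_right: "dot d (x + y) = dot d x + dot d y"
  by (simp add: dot_def sum.distrib distrib_left)

lemma dot_scale_left: "dot (k *s x) d = k * dot x d"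
  by (simp add: dot_def sum_distrib_left mult.assoc)

lemma dot_scale_right: "dot d (k *s x) = k * dot d x"
  by (simp add: dot_def sum_distrib_left ac_simps)

lemma subspace_dual: "vec.subspace (dual C)"
  by (auto simp: vec.subspace_def dual_def dot_add_right dot_scale_right dot_def[of _ 0])

lemma dual_antimono: "C \<subseteq> D \<Longrightarrow> dual D \<subseteq> dual C"
  by (auto simp: dual_def)

lemma dot_eq_0_on_span:
  assumes "c \<in> vec.span B" and "\<And>x. x \<in> B \<Longrightarrow> dot x d = 0"
  shows "dot c d = 0"
  using assms(1)
  by (induction rule: vec.span_induct_alt)
     (auto simp: assms(2) dot_add_left dot_scale_left dot_def[of 0])

text \<open>
  The form \<open>dot\<close> may have isotropic vectors, so \<open>dual W\<close> need not be a complement of \<open>W\<close>.  Extend a basis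
  of \<open>W\<close> to one of the whole space and let it be the rows of a matrix \<open>P\<close>: the automorphism
  \<open>d \<mapsto> P *v d\<close> carries \<open>dual W\<close> onto the vectors that vanish in the coordinates belonging to \<open>W\<close>.
\<close>

lemma dim_dual:
  fixes W :: "('a::field ^ 'n) set"
  shows "vec.dim (dual W) + vec.dim W = CARD('n)"
proof -
  obtain B0 where B0: "B0 \<subseteq> W" "vec.independent B0" "W \<subseteq> vec.span B0" "card B0 = vec.dim W"
    by (rule vec.basis_exists)
  obtain B where B: "B0 \<subseteq> B" "vec.independent B" "UNIV \<subseteq> vec.span B"
    by (rule vec.maximal_independent_subset_extend[OF subset_UNIV B0(2)])
  have finB: "finite B"
    using B(2) by (rule vec.finiteI_independent)
  have "card B = CARD('n)"
    using vec.basis_card_eq_dim[of B UNIV] B by (simp add: card_cart_basis)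
  then obtain f :: "'n \<Rightarrow> 'a ^ 'n" where f: "bij_betw f UNIV B"
    using finite_same_card_bij[of "UNIV :: 'n set" B] finB by auto
  define P :: "'a ^ 'n ^ 'n" where "P = (\<chi> i. f i)"
  have P: "(P *v d) $ i = dot (f i) d" for d i
    by (simp add: P_def matrix_vector_mult_def dot_def)
  have lin: "Vector_Spaces.linear (*s) (*s) ((*v) P)" ..
  have rng: "range f = B"
    using f by (auto simp: bij_betw_def)
  have inj: "inj ((*v) P)"
  proof (subst vec.inj_iff_eq_0, intro allI impI)
    fix x assume "P *v x = 0"
    then have "dot (f i) x = 0" for i
      by (metis P zero_index)
    then have *: "dot c x = 0" for c
      using dot_eq_0_on_span[of c B x] B(3) rng by auto
    have "x $ i = 0" for i
      using *[of "axis i 1"] by (simp add: dot_def axis_def if_distrib[of "\<lambda>z. z * _"] cong: if_cong)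
    then show "x = 0" by (simp add: vec_eq_iff)
  qed
  then have surj: "surj ((*v) P)"
    using vec.linear_inj_imp_surj[OF lin] by blast
  have dW: "dual W = {d. \<forall>x\<in>B0. dot x d = 0}"
  proof
    show "dual W \<subseteq> {d. \<forall>x\<in>B0. dot x d = 0}"
      using B0(1) by (auto simp: dual_def)
    show "{d. \<forall>x\<in>B0. dot x d = 0} \<subseteq> dual W"
      using dot_eq_0_on_span[of _ B0] B0(3) by (auto simp: dual_def)
  qed
  have img: "(*v) P ` dual W = {y. \<forall>i. i \<notin> {i. f i \<notin> B0} \<longrightarrow> y $ i = 0}" (is "_ = ?E")
  proof (intro equalityI subsetI)
    fix y assume y: "y \<in> ?E"
    obtain d where d: "y = P *v d"
      using surj by (metis surjD)
    have "dot x d = 0" if "x \<in> B0" for x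
    proof -
      have "x \<in> range f" using that B(1) rng by blast
      then obtain i where "x = f i" ..
      then show ?thesis using y that P[of d i] d by auto
    qed
    then show "y \<in> (*v) P ` dual W" using d dW by auto
  qed (auto simp: dW P)
  have "inj_on ((*v) P) (vec.span (dual W))"
    using inj by (rule inj_on_subset) simp
  then have "vec.dim (dual W) = vec.dim ((*v) P ` dual W)"
    by (rule vec.dim_image_eq[OF lin, symmetric])
  also have "\<dots> = card {i. f i \<notin> B0}"
    unfolding img by (rule dim_substandard_cart)
  also have "\<dots> = CARD('n) - card {i. f i \<in> B0}"
    by (subst card_Diff_subset[symmetric]) (auto intro!: arg_cong[where f = card])
  also have "card {i. f i \<in> B0} = card (f ` {i. f i \<in> B0})"
    using f by (intro card_image[symmetric]) (auto simp: bij_betw_def inj_on_def)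
  also have "f ` {i. f i \<in> B0} = B0"
    using rng B(1) by auto
  finally show ?thesis
    using B0(4) dim_subset_UNIV_cart_gen[of W] by simp
qed

text \<open>
  When a basis of \<open>E2\<close> is extended to one of \<open>E1\<close>, any \<open>r\<close> of the added vectors span such a space.
\<close>

lemma exists_subspace_avoiding:
  fixes E1 E2 :: "('a::field ^ 'n) set"
  assumes "vec.subspace E1" "vec.subspace E2" "E2 \<subseteq> E1" "r + vec.dim E2 \<le> vec.dim E1"
  obtains D where "vec.subspace D" "D \<subseteq> E1" "D \<inter> E2 = {0}" "vec.dim D = r"
proof -
  obtain B2 where B2: "B2 \<subseteq> E2" "vec.independent B2" "E2 \<subseteq> vec.span B2" "card B2 = vec.dim E2"
    by (rule vec.basis_exists)
  obtain B1 where B1: "B2 \<subseteq> B1" "B1 \<subseteq> E1" "vec.independent B1" "E1 \<subseteq> vec.span B1"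
    by (rule vec.maximal_independent_subset_extend[OF subset_trans[OF B2(1) assms(3)] B2(2)])
  have fin: "finite B1" using B1(3) by (rule vec.finiteI_independent)
  have "card B1 = vec.dim E1"
    using B1(2,4,3) by (rule vec.basis_card_eq_dim)
  then have "r \<le> card (B1 - B2)"
    using assms(4) B2(4) B1(1) fin by (simp add: card_Diff_subset finite_subset)
  then obtain T where T: "T \<subseteq> B1 - B2" "card T = r"
    by (rule obtain_subset_with_card_n)
  have finT: "finite T" "finite B2"
    using fin T B1(1) finite_subset by blast+
  have ind: "vec.independent T" "vec.independent (T \<union> B2)"
    using T(1) B1(1) by (auto intro!: vec.independent_mono[OF B1(3)])
  have E2: "vec.span B2 = E2"
    using B2(1,3) assms(2) by (rule vec.span_subspace)
  have "vec.dim {x + y |x y. x \<in> vec.span T \<and> y \<in> vec.span B2}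
        + vec.dim (vec.span T \<inter> vec.span B2) = vec.dim (vec.span T) + vec.dim (vec.span B2)"
    by (rule vec.dim_sums_Int) auto
  moreover have "vec.dim {x + y |x y. x \<in> vec.span T \<and> y \<in> vec.span B2} = card T + card B2"
    using vec.dim_span_eq_card_independent[OF ind(2)] T(1) finT
    by (subst (asm) card_Un_disjoint) (auto simp: vec.span_Un)
  ultimately have "vec.dim (vec.span T \<inter> vec.span B2) = 0"
    using vec.dim_span_eq_card_independent[OF ind(1)] vec.dim_span_eq_card_independent[OF B2(2)]
    by linarith
  then have "vec.span T \<inter> E2 \<subseteq> {0}"
    using E2 by simp
  moreover have "0 \<in> vec.span T \<inter> E2"
    using vec.span_zero vec.subspace_0[OF assms(2)] by simp
  ultimately have "vec.span T \<inter> E2 = {0}" by blast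
  moreover have "vec.span T \<subseteq> E1"
    using T(1) B1(2) assms(1) by (intro vec.span_minimal) auto
  moreover have "vec.dim (vec.span T) = r"
    using vec.dim_span_eq_card_independent[OF ind(1)] T(2) by simp
  ultimately show ?thesis by (intro that[OF vec.subspace_span])
qed

text \<open>
  \<open>Min\<close> is only meaningful on a nonempty set; the condition on dimensions provides a member.
\<close>

lemma rghw_attained:
  fixes E1 E2 :: "('a::field ^ 'n) set"
  assumes "vec.subspace E1" "vec.subspace E2" "E2 \<subseteq> E1" "r + vec.dim E2 \<le> vec.dim E1"
  obtains D where "vec.subspace D" "D \<subseteq> E1" "D \<inter> E2 = {0}" "vec.dim D = r"
    "card (Supp D) = rghw r E1 E2"
proof -
  let ?M = "{card (Supp D) | D. vec.subspace D \<and> D \<subseteq> E1 \<and> D \<inter> E2 = {0} \<and> vec.dim D = r}"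
  have "finite ?M"
    by (rule finite_subset[of _ "card ` UNIV"]) auto
  moreover obtain D where "vec.subspace D" "D \<subseteq> E1" "D \<inter> E2 = {0}" "vec.dim D = r"
    by (rule exists_subspace_avoiding[OF assms])
  then have "?M \<noteq> {}" by auto
  ultimately have "rghw r E1 E2 \<in> ?M"
    unfolding rghw_def by (rule Min_in)
  then show ?thesis using that by auto
qed

text \<open>
  Vectors of \<open>C1\<close> that vanish on the support of \<open>D\<close> are orthogonal to \<open>D\<close>, and so is \<open>C2\<close>.  On the
  other hand \<open>D\<close> embeds into the linear functionals on \<open>C1\<close>, since it meets \<open>dual C1\<close> trivially.  So
  \<open>dim D\<close> is at most the codimension in \<open>C1\<close> of the sum of \<open>C2\<close> and the span of those vectors.
\<close>

lemma no_independent_vanishing_on_Supp: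
  fixes C1 C2 D :: "('a::field ^ 'n) set"
  assumes sub: "vec.subspace C1" "vec.subspace C2" "C2 \<subseteq> C1"
    and D: "vec.subspace D" "D \<subseteq> dual C2" "D \<inter> dual C1 = {0}"
    and dim: "vec.dim C1 < vec.dim C2 + vec.dim D + k"
  shows "\<not> has_independent_vanishing k C1 C2 (Supp D)"
proof
  assume "has_independent_vanishing k C1 C2 (Supp D)"
  then obtain S where S: "S \<subseteq> C1 - C2" "card S = k" "vec.independent S"
      "vec.span S \<inter> C2 = {0}" "\<forall>c\<in>S. \<forall>i\<in>Supp D. c $ i = 0"
    by (auto simp: has_independent_vanishing_def independent_mod_def)
  define W where "W = {x + y |x y. x \<in> vec.span S \<and> y \<in> C2}"
  have "vec.dim W + vec.dim (vec.span S \<inter> C2) = vec.dim (vec.span S) + vec.dim C2"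
    unfolding W_def by (rule vec.dim_sums_Int) (use sub in auto)
  then have dimW: "vec.dim W = k + vec.dim C2"
    using S vec.dim_span_eq_card_independent[OF S(3)] by simp
  have "vec.span S \<subseteq> C1"
    using S(1) sub(1) by (intro vec.span_minimal) auto
  then have "W \<subseteq> C1"
    using sub by (auto simp: W_def intro: vec.subspace_add)
  then have W1: "dual C1 \<subseteq> dual W" by (rule dual_antimono)
  have "dot c d = 0" if "c \<in> S" "d \<in> D" for c d
    unfolding dot_def using S(5) that by (intro sum.neutral) (auto simp: Supp_def)
  then have "dot c d = 0" if "c \<in> vec.span S" "d \<in> D" for c d
    using dot_eq_0_on_span[OF that(1)] that(2) by blast
  then have W2: "D \<subseteq> dual W"
    using D(2) by (auto simp: W_def dual_def dot_add_left)
  have "vec.dim {x + y |x y. x \<in> D \<and> y \<in> dual C1} + vec.dim (D \<inter> dual C1)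
        = vec.dim D + vec.dim (dual C1)"
    by (rule vec.dim_sums_Int) (use D subspace_dual in auto)
  moreover have "{x + y |x y. x \<in> D \<and> y \<in> dual C1} \<subseteq> dual W"
    using W1 W2 subspace_dual[of W] by (auto intro: vec.subspace_add)
  then have "vec.dim {x + y |x y. x \<in> D \<and> y \<in> dual C1} \<le> vec.dim (dual W)"
    by (rule vec.dim_subset)
  ultimately have "vec.dim D + vec.dim (dual C1) \<le> vec.dim (dual W)"
    using D(3) by simp
  then show False
    using dim_dual[of C1] dim_dual[of W] dimW dim by linarith
qed

section \<open>The flag of an ordered basis\<close>

lemma subspace_flag: "vec.subspace (flag b i)"
  by (simp add: flag_def)

lemma flag_mono: "i \<le> j \<Longrightarrow> flag b i \<subseteq> flag b j"
  unfolding flag_def by (intro vec.span_mono image_mono) auto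

lemma flag_0: "flag b 0 = {0}"
  by (simp add: flag_def)

lemma flag_CARD:
  fixes b :: "nat \<Rightarrow> 'a::field ^ 'n"
  shows "ordered_basis b \<Longrightarrow> flag b CARD('n) = UNIV"
  by (simp add: ordered_basis_def flag_def)

lemma dim_flag:
  fixes b :: "nat \<Rightarrow> 'a::field ^ 'n"
  assumes "ordered_basis b" "i \<le> CARD('n)"
  shows "vec.dim (flag b i) = i"
proof -
  have sub: "{1..i} \<subseteq> {1..CARD('n)}" using assms(2) by auto
  have "vec.independent (b ` {1..i})" "inj_on b {1..i}"
    using assms(1) vec.independent_mono[OF _ image_mono[OF sub], of b] inj_on_subset[OF _ sub, of b]
    by (simp_all add: ordered_basis_def)
  then show ?thesis
    by (simp add: flag_def vec.dim_eq_card_independent card_image)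
qed

lemma flag_step:
  assumes "1 \<le> i" "x \<in> flag b i"
  obtains \<alpha> where "x - \<alpha> *s b i \<in> flag b (i - 1)"
proof -
  have "{1..i} = insert i {1..i - 1}" using assms(1) by auto
  then show ?thesis
    using assms(2) that vec.span_breakdown_eq unfolding flag_def by (metis image_insert)
qed

lemma rho_bar_unique:
  fixes b :: "nat \<Rightarrow> 'a::field ^ 'n"
  assumes "i \<in> {1..CARD('n)}" "c \<in> flag b i - flag b (i - 1)"
  shows "rho_bar b c = i"
proof -
  have "c \<noteq> 0" using assms(2) vec.subspace_0[OF subspace_flag] by blast
  moreover have "j = i" if "c \<in> flag b j - flag b (j - 1)" for j
  proof (rule ccontr)
    assume "j \<noteq> i"
    then have "j \<le> i - 1 \<or> i \<le> j - 1" by linarith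
    then show False
      using that assms(2) flag_mono[of j "i - 1" b] flag_mono[of i "j - 1" b] by blast
  qed
  then have "(THE j. j \<in> {1..CARD('n)} \<and> c \<in> flag b j - flag b (j - 1)) = i"
    using assms by (intro the_equality) blast+
  ultimately show ?thesis
    by (simp add: rho_bar_def)
qed

lemma rho_bar_nonzero:
  fixes b :: "nat \<Rightarrow> 'a::field ^ 'n"
  assumes "ordered_basis b" "c \<noteq> 0"
  shows "rho_bar b c \<in> {1..CARD('n)}" "c \<in> flag b (rho_bar b c) - flag b (rho_bar b c - 1)"
proof -
  define i where "i = (LEAST i. c \<in> flag b i)"
  have ex: "c \<in> flag b CARD('n)" using flag_CARD[OF assms(1)] by simp
  have ci: "c \<in> flag b i"
    unfolding i_def using ex by (rule LeastI)
  have le: "i \<le> CARD('n)"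
    unfolding i_def using ex by (rule Least_le)
  have ge: "1 \<le> i"
    using ci assms(2) flag_0[of b] by (cases i) auto
  have "c \<notin> flag b (i - 1)"
    using not_less_Least[of "i - 1" "\<lambda>i. c \<in> flag b i"] ge by (auto simp: i_def[symmetric])
  then have "rho_bar b c = i" "i \<in> {1..CARD('n)}"
    using rho_bar_unique[of i c b] ci ge le by auto
  then show "rho_bar b c \<in> {1..CARD('n)}" "c \<in> flag b (rho_bar b c) - flag b (rho_bar b c - 1)"
    using ci \<open>c \<notin> flag b (i - 1)\<close> by auto
qed

lemma in_flag_rho_bar: "ordered_basis b \<Longrightarrow> rho_bar b c \<le> i \<Longrightarrow> c \<in> flag b i"
  using rho_bar_nonzero(2)[of b c] flag_mono[of "rho_bar b c" i b]
    vec.subspace_0[OF subspace_flag] by (cases "c = 0") blast+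

lemma rho_bar_0: "rho_bar b 0 = 0"
  by (simp add: rho_bar_def)

section \<open>Leading indices of a subspace\<close>

definition leading_indices :: "(nat \<Rightarrow> 'a::field ^ 'n) \<Rightarrow> ('a ^ 'n) set \<Rightarrow> nat set" where
  "leading_indices b W = rho_bar b ` (W - {0})"

lemma leading_indices_subset:
  fixes b :: "nat \<Rightarrow> 'a::field ^ 'n"
  shows "ordered_basis b \<Longrightarrow> leading_indices b W \<subseteq> {1..CARD('n)}"
  using rho_bar_nonzero(1) unfolding leading_indices_def by blast

lemma leading_indices_choice:
  obtains x where "\<And>l. l \<in> leading_indices b W \<Longrightarrow> x l \<in> W \<and> x l \<noteq> 0 \<and> rho_bar b (x l) = l"
proof -
  have "\<forall>l\<in>leading_indices b W. \<exists>x. x \<in> W \<and> x \<noteq> 0 \<and> rho_bar b x = l"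
    by (auto simp: leading_indices_def)
  then show ?thesis using that by metis
qed

text \<open>
  One vector of \<open>W\<close> per leading index suffices to span \<open>W\<close>: subtracting a multiple of the one with the
  same leading index as \<open>w\<close> cancels the leading term of \<open>w\<close>, which is Gaussian elimination along
  the flag.
\<close>

lemma dim_le_card_leading_indices:
  fixes b :: "nat \<Rightarrow> 'a::field ^ 'n"
  assumes b: "ordered_basis b" and W: "vec.subspace W"
  shows "vec.dim W \<le> card (leading_indices b W)"
proof -
  obtain x where x: "\<And>l. l \<in> leading_indices b W \<Longrightarrow> x l \<in> W \<and> x l \<noteq> 0 \<and> rho_bar b (x l) = l"
    using leading_indices_choice by blast
  have fin: "finite (leading_indices b W)"
    using leading_indices_subset[OF b] finite_subset by blast
  have "w \<in> vec.span (x ` leading_indices b W)" if "w \<in> W" for w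
    using that
  proof (induction "rho_bar b w" arbitrary: w rule: less_induct)
    case less
    show ?case
    proof (cases "w = 0")
      case True
      then show ?thesis by (simp add: vec.span_zero)
    next
      case False
      define l where "l = rho_bar b w"
      have l: "l \<in> leading_indices b W" "1 \<le> l"
        using False less.prems rho_bar_nonzero(1)[OF b False] by (auto simp: leading_indices_def l_def)
      have w: "w \<in> flag b l" using rho_bar_nonzero(2)[OF b False] by (simp add: l_def)
      have xl: "x l \<in> flag b l - flag b (l - 1)"
        using rho_bar_nonzero(2)[OF b, of "x l"] x[OF l(1)] by simp
      obtain \<alpha> where \<alpha>: "w - \<alpha> *s b l \<in> flag b (l - 1)" using flag_step[OF l(2) w] .
      obtain \<beta> where \<beta>: "x l - \<beta> *s b l \<in> flag b (l - 1)" using flag_step[OF l(2)] xl by blast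
      have "\<beta> \<noteq> 0" using \<beta> xl by auto
      \<comment> \<open>\<open>\<alpha>\<close> and \<open>\<beta>\<close> are the leading coefficients of \<open>w\<close> and \<open>x l\<close>.\<close>
      let ?z = "w - (\<alpha> / \<beta>) *s x l"
      have "?z = (w - \<alpha> *s b l) - (\<alpha> / \<beta>) *s (x l - \<beta> *s b l)"
        using \<open>\<beta> \<noteq> 0\<close> by (simp add: vec_eq_iff algebra_simps)
      then have zf: "?z \<in> flag b (l - 1)"
        using \<alpha> \<beta> subspace_flag by (metis vec.subspace_diff vec.subspace_scale)
      have zW: "?z \<in> W"
        using W less.prems x[OF l(1)] by (blast intro: vec.subspace_diff vec.subspace_scale)
      have "rho_bar b ?z < l"
      proof (cases "?z = 0")
        case True
        then show ?thesis using l(2) by (simp add: rho_bar_0)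
      next
        case False
        show ?thesis
        proof (rule ccontr)
          assume "\<not> rho_bar b ?z < l"
          then have "l - 1 \<le> rho_bar b ?z - 1" by simp
          then show False
            using rho_bar_nonzero(2)[OF b False] zf flag_mono by blast
        qed
      qed
      then have "?z \<in> vec.span (x ` leading_indices b W)"
        using less.hyps zW l_def by blast
      moreover have "(\<alpha> / \<beta>) *s x l \<in> vec.span (x ` leading_indices b W)"
        using l(1) by (intro vec.span_scale vec.span_base) simp
      ultimately show ?thesis
        using vec.span_add[of ?z] by fastforce
    qed
  qed
  then have "vec.dim W \<le> card (x ` leading_indices b W)"
    using fin by (intro vec.dim_le_card) auto
  then show ?thesis using card_image_le[OF fin, of x] by linarith
qed

text \<open>
  The vectors are in echelon form.  Adding them by increasing leading index, each new \<open>x m\<close> lies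
  outside \<open>flag b (m - 1)\<close>, which contains both \<open>flag b k\<close> and all the earlier vectors.
\<close>

lemma distinct_rho_bar_independent_mod_flag:
  fixes b :: "nat \<Rightarrow> 'a::field ^ 'n"
  assumes b: "ordered_basis b" and "finite L"
    and "\<And>l. l \<in> L \<Longrightarrow> k < l \<and> x l \<noteq> 0 \<and> rho_bar b (x l) = l"
  shows "independent_mod (flag b k) (x ` L)"
  using assms(2,3)
proof (induction L rule: finite_linorder_max_induct)
  case empty
  then show ?case
    using vec.subspace_0[OF subspace_flag[of b k]] vec.independent_empty
    by (simp add: independent_mod_def)
next
  case (insert m L)
  have IH: "vec.independent (x ` L)" "vec.span (x ` L) \<inter> flag b k = {0}"
    using insert by (auto simp: independent_mod_def)
  have xm: "x m \<notin> flag b (m - 1)" and km: "k \<le> m - 1"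
    using rho_bar_nonzero(2)[OF b, of "x m"] insert.prems[of m] by auto
  have "x l \<in> flag b (m - 1)" if "l \<in> L" for l
    using in_flag_rho_bar[OF b, of "x l" "m - 1"] insert.hyps(2) insert.prems[of l] that by fastforce
  then have sp: "vec.span (x ` L) \<subseteq> flag b (m - 1)"
    using subspace_flag by (intro vec.span_minimal) auto
  then have ind: "vec.independent (insert (x m) (x ` L))"
    using xm IH(1) by (intro vec.independent_insertI) auto
  have "z = 0" if z: "z \<in> vec.span (insert (x m) (x ` L))" "z \<in> flag b k" for z
  proof -
    obtain \<alpha> where \<alpha>: "z - \<alpha> *s x m \<in> vec.span (x ` L)"
      using vec.span_breakdown_eq[of z "x m"] z(1) by blast
    have "\<alpha> = 0"
    proof (rule ccontr)
      assume "\<alpha> \<noteq> 0"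
      have "z \<in> flag b (m - 1)" using z(2) flag_mono[OF km] by blast
      then have "z - (z - \<alpha> *s x m) \<in> flag b (m - 1)"
        using \<alpha> sp subspace_flag by (blast intro: vec.subspace_diff)
      then have "\<alpha> *s x m \<in> flag b (m - 1)" by simp
      then have "(1 / \<alpha>) *s (\<alpha> *s x m) \<in> flag b (m - 1)"
        by (rule vec.subspace_scale[OF subspace_flag])
      then show False using xm \<open>\<alpha> \<noteq> 0\<close> by simp
    qed
    then show ?thesis using \<alpha> z(2) IH(2) by auto
  qed
  moreover have "0 \<in> flag b k" using vec.subspace_0[OF subspace_flag] .
  ultimately show ?case
    using ind vec.span_zero by (auto simp: independent_mod_def)
qed

section \<open>The Feng--Rao argument for ideals\<close>

text \<open>
  Multiplication by \<open>b' j\<close> moves a leading index \<open>i\<close> of the ideal \<open>W\<close> to \<open>l\<close> when \<open>(i, j)\<close> is one-way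
  well-behaving, so a leading index \<open>i \<in> V_l\<close> would make \<open>l\<close> a leading index.  The bound \<open>1 \<le> l\<close>
  excludes pairs with \<open>b i * b' j = 0\<close>, for which the product of \<open>b' j\<close> with a vector of leading index \<open>i\<close> is zero.
\<close>

lemma V_set_disjoint_leading_indices:
  fixes b b' :: "nat \<Rightarrow> 'a::field ^ 'n"
  assumes b: "ordered_basis b" and W: "\<And>x y. x \<in> W \<Longrightarrow> x * y \<in> W"
    and l: "1 \<le> l" "l \<notin> leading_indices b W"
  shows "V_set b b' l \<inter> leading_indices b W = {}"
proof (rule ccontr)
  assume "V_set b b' l \<inter> leading_indices b W \<noteq> {}"
  then obtain i j x where i: "i \<in> {1..CARD('n)}" and owb: "OWB b b' i j"
      and ij: "rho_bar b (b i * b' j) = l" and x: "x \<in> W" "x \<noteq> 0" "rho_bar b x = i"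
    by (auto simp: V_set_def leading_indices_def)
  have xi: "x \<in> flag b i - flag b (i - 1)" using rho_bar_nonzero(2)[OF b x(2)] x(3) by simp
  obtain \<alpha> where \<alpha>: "x - \<alpha> *s b i \<in> flag b (i - 1)" using flag_step[of i x b] i xi by auto
  have "\<alpha> \<noteq> 0" using \<alpha> xi by auto
  have low: "y * b' j \<in> flag b (l - 1)" if "y \<in> flag b (i - 1)" for y
    using that unfolding flag_def[of b "i - 1"]
  proof (induction rule: vec.span_induct_alt)
    case base
    then show ?case using vec.subspace_0[OF subspace_flag] by simp
  next
    case (step c v y)
    then obtain u where u: "v = b u" "u \<in> {1..CARD('n)}" "u < i" using i by auto
    then have "rho_bar b (v * b' j) \<le> l - 1"
      using owb ij by (auto simp: OWB_def)
    then have "v * b' j \<in> flag b (l - 1)" using in_flag_rho_bar[OF b] by blast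
    moreover have "(c *s v + y) * b' j = c *s (v * b' j) + y * b' j"
      by (simp add: vec_eq_iff algebra_simps)
    ultimately show ?case
      using step subspace_flag by (metis vec.subspace_add vec.subspace_scale)
  qed
  \<comment> \<open>Now \<open>x * b' j\<close> is a nonzero multiple of \<open>p\<close>, of leading index \<open>l\<close>, plus a lower term \<open>r\<close>.\<close>
  define p where "p = b i * b' j"
  have "p \<noteq> 0" using ij l(1) by (auto simp: p_def rho_bar_0)
  then have p: "p \<in> flag b l - flag b (l - 1)" and ln: "l \<in> {1..CARD('n)}"
    using rho_bar_nonzero[OF b, of p] ij by (auto simp: p_def)
  define r where "r = (x - \<alpha> *s b i) * b' j"
  have r: "r \<in> flag b (l - 1)" using low[OF \<alpha>] by (simp add: r_def)
  have eq: "x * b' j = \<alpha> *s p + r"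
    by (simp add: vec_eq_iff p_def r_def algebra_simps)
  have "x * b' j \<in> flag b l"
    unfolding eq using p r flag_mono[of "l - 1" l b] subspace_flag
    by (blast intro: vec.subspace_add vec.subspace_scale diff_le_self)
  moreover have "x * b' j \<notin> flag b (l - 1)"
  proof
    assume "x * b' j \<in> flag b (l - 1)"
    then have "(1 / \<alpha>) *s (x * b' j - r) \<in> flag b (l - 1)"
      using r subspace_flag by (blast intro: vec.subspace_diff vec.subspace_scale)
    then show False using eq p \<open>\<alpha> \<noteq> 0\<close> by simp
  qed
  ultimately have "rho_bar b (x * b' j) = l"
    using rho_bar_unique[OF ln] by blast
  moreover have "x * b' j \<noteq> 0"
    using \<open>x * b' j \<notin> flag b (l - 1)\<close> vec.subspace_0[OF subspace_flag] by metis
  ultimately show False using l(2) W[OF x(1)] by (auto simp: leading_indices_def)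
qed

definition vanishing_on :: "'n set \<Rightarrow> ('a::field ^ 'n) set" where
  "vanishing_on A = {x. \<forall>i\<in>A. x $ i = 0}"

lemma subspace_vanishing_on: "vec.subspace (vanishing_on A)"
  by (auto simp: vec.subspace_def vanishing_on_def)

lemma vanishing_on_mult: "x \<in> vanishing_on A \<Longrightarrow> x * y \<in> vanishing_on A"
  by (simp add: vanishing_on_def)

lemma dim_vanishing_on:
  fixes A :: "'n::finite set"
  shows "vec.dim (vanishing_on A :: ('a::field ^ 'n) set) = CARD('n) - card A"
  using dim_substandard_cart[of "- A", where 'a = 'a]
  by (simp add: vanishing_on_def Compl_eq_Diff_UNIV card_Diff_subset Ball_def)

text \<open>
  The numbers counted by \<open>mu_bar\<close> all lie in the complement of the set of leading indices, whose size is
  at most the codimension \<open>card A\<close> of \<open>vanishing_on A\<close>.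
\<close>

lemma mu_bar_le_card_zeros:
  fixes b b' :: "nat \<Rightarrow> 'a::field ^ 'n" and A :: "'n set"
  assumes b: "ordered_basis b" and ls: "ls \<subseteq> {1..CARD('n)} - leading_indices b (vanishing_on A)"
  shows "mu_bar b b' ls \<le> card A"
proof -
  let ?L = "leading_indices b (vanishing_on A)"
  have "V_set b b' l \<inter> ?L = {}" if "l \<in> ls" for l
    using ls that by (intro V_set_disjoint_leading_indices[OF b vanishing_on_mult]) auto
  then have "(\<Union>l\<in>ls. V_set b b' l) \<union> ls \<subseteq> {1..CARD('n)} - ?L"
    using ls by (auto simp: V_set_def)
  then have "mu_bar b b' ls \<le> card ({1..CARD('n)} - ?L)"
    unfolding mu_bar_def by (intro card_mono) auto
  also have "\<dots> = CARD('n) - card ?L"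
    using leading_indices_subset[OF b] by (subst card_Diff_subset) (auto intro: finite_subset)
  also have "\<dots> \<le> card A"
    using dim_le_card_leading_indices[OF b subspace_vanishing_on[of A]]
    unfolding dim_vanishing_on by linarith
  finally show ?thesis .
qed

section \<open>Independent vectors vanishing on a set of coordinates\<close>

theorem theorem17:
  fixes b b' :: "nat \<Rightarrow> 'a::field ^ 'n"
    and k1 k2 k t a :: nat
    and C1 C2 :: "('a ^ 'n) set"
  assumes "ordered_basis b" and "ordered_basis b'"
    and "1 \<le> k2" and "k2 < k1" and "k1 \<le> CARD('n)"
    and "C1 = vec.span (b ` {1..k1})" and "C2 = vec.span (b ` {1..k2})"
    and "t = k1 - k2"
    and "1 \<le> k" and "k \<le> t"
    and "a = Min {mu_bar b b' ls | ls. ls \<subseteq> {k2<..k1} \<and> card ls = t - k + 1}"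
  shows "(\<forall>A :: 'n set. card A < a \<longrightarrow> has_independent_vanishing k C1 C2 A) \<and>
         (rghw (t - k + 1) (dual C2) (dual C1) = a \<longrightarrow>
            (\<exists>A :: 'n set. card A = a \<and> \<not> has_independent_vanishing k C1 C2 A))"
proof (intro conjI allI impI)
  have C1: "C1 = flag b k1" and C2: "C2 = flag b k2"
    using assms(6,7) by (simp_all add: flag_def)
  let ?M = "{mu_bar b b' ls | ls. ls \<subseteq> {k2<..k1} \<and> card ls = t - k + 1}"
  have finM: "finite ?M"
    by (rule finite_subset[of _ "mu_bar b b' ` Pow {k2<..k1}"]) auto
  fix A :: "'n set"
  assume A: "card A < a"
  define L where "L = leading_indices b (vanishing_on A) \<inter> {k2<..k1}"
  have "k \<le> card L"
  proof (rule ccontr)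
    assume "\<not> k \<le> card L"
    moreover have "card ({k2<..k1} - L) = t - card L"
      using assms(8) by (subst card_Diff_subset) (auto simp: L_def)
    ultimately have "t - k + 1 \<le> card ({k2<..k1} - L)"
      using assms(10) by simp
    then obtain ls where ls: "ls \<subseteq> {k2<..k1} - L" "card ls = t - k + 1"
      by (rule obtain_subset_with_card_n)
    then have "mu_bar b b' ls \<in> ?M" by blast
    then have "a \<le> mu_bar b b' ls"
      using assms(11) finM by simp
    moreover have "mu_bar b b' ls \<le> card A"
      using ls(1) assms(5) by (intro mu_bar_le_card_zeros[OF assms(1)]) (fastforce simp: L_def)
    ultimately show False using A by simp
  qed
  then obtain L' where L': "L' \<subseteq> L" "card L' = k" "finite L'"
    by (rule obtain_subset_with_card_n)
  obtain x where x: "\<And>l. l \<in> leading_indices b (vanishing_on A) \<Longrightarrow>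
      x l \<in> vanishing_on A \<and> x l \<noteq> 0 \<and> rho_bar b (x l) = l"
    using leading_indices_choice by blast
  have xL: "x l \<in> vanishing_on A" "x l \<noteq> 0" "rho_bar b (x l) = l" "k2 < l" "l \<le> k1"
    if "l \<in> L'" for l
    using that L'(1) x by (auto simp: L_def)
  have "x l \<in> C1 - C2" if "l \<in> L'" for l
  proof -
    have "x l \<in> flag b l - flag b (l - 1)"
      using rho_bar_nonzero(2)[OF assms(1)] xL[OF that] by metis
    moreover have "flag b l \<subseteq> flag b k1" "flag b k2 \<subseteq> flag b (l - 1)"
      using xL(4,5)[OF that] by (auto intro!: flag_mono)
    ultimately show ?thesis unfolding C1 C2 by blast
  qed
  moreover have "inj_on x L'"
    using xL(3) by (metis inj_onI)
  then have "card (x ` L') = k"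
    using L'(2) by (simp add: card_image)
  moreover have "independent_mod C2 (x ` L')"
    unfolding C2 using L'(3) xL by (intro distinct_rho_bar_independent_mod_flag[OF assms(1)]) auto
  ultimately show "has_independent_vanishing k C1 C2 A"
    unfolding has_independent_vanishing_def using L'(3) xL(1)
    by (intro exI[of _ "x ` L'"]) (auto simp: vanishing_on_def)
next
  have C1: "C1 = flag b k1" and C2: "C2 = flag b k2"
    using assms(6,7) by (simp_all add: flag_def)
  assume a: "rghw (t - k + 1) (dual C2) (dual C1) = a"
  have sub: "vec.subspace C1" "vec.subspace C2" "C2 \<subseteq> C1"
    using subspace_flag flag_mono[of k2 k1 b] assms(4) by (auto simp: C1 C2)
  have dims: "vec.dim C1 = k1" "vec.dim C2 = k2"
    using dim_flag[OF assms(1)] assms(4,5) by (auto simp: C1 C2)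
  have "t - k + 1 + vec.dim (dual C1) \<le> vec.dim (dual C2)"
    using dim_dual[of C1] dim_dual[of C2] dims assms(4,8,9) by linarith
  then obtain D where D: "vec.subspace D" "D \<subseteq> dual C2" "D \<inter> dual C1 = {0}"
      "vec.dim D = t - k + 1" "card (Supp D) = a"
    using rghw_attained[OF subspace_dual subspace_dual dual_antimono[OF sub(3)]] a by metis
  have "vec.dim C1 < vec.dim C2 + vec.dim D + k"
    using dims D(4) assms(4,8,9,10) by linarith
  then show "\<exists>A :: 'n set. card A = a \<and> \<not> has_independent_vanishing k C1 C2 A"
    using no_independent_vanishing_on_Supp[OF sub D(1-3)] D(5) by blast
qed

end
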